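(* Let $N\subseteq M$ be real Banach spaces such that $N$ is a $\kappa$ ideal in $M$ for some uncountable cardinal $\kappa$. Then $\mathcal F(N)$ is a $\kappa$ ideal in $\mathcal F(M)$ through the canonical inclusion $\mathcal F(N)\to\mathcal F(M)$.
   Context: For a normed space $Z$, $\operatorname{dens}(Z)$ is the least cardinality of a subset of $Z$ whose linear span is dense in $Z$. A subspace $Y$ of a Banach space $W$ is a $\kappa$ ideal in $W$ if for every subspace $E\subseteq W$ with $\operatorname{dens}(E)<\kappa$ there is a linear operator $P:E\to Y$ with $\|P\|\le 1$ and $P(e)=e$ for all $e\in E\cap Y$. For a metric space $M$ with a distinguished point $0$ (for a Banach space, its zero vector), $\mathrm{Lip}_0(M)$ is the Banach space of Lipschitz functions $f:M\to\mathbb R$ with $f(0)=0$, normed by the best Lipschitz constant. For $x\in M$ let $\delta_M(x)\in \mathrm{Lip}_0(M)^*$ be $\langle f,\delta_M(x)\rangle=f(x)$. The Lipschitz-free space $\mathcal F(M)$ is the closed linear span of $\{\delta_M(x):x\in M\}$ in $\mathrm{Lip}_0(M)^*$. For $N\subseteq M$ containing $0$, the canonical inclusion $\mathcal F(N)\to\mathcal F(M)$ is the linear isometric embedding determined by $\delta_N(x)\mapsto\delta_M(x)$, $x\in N$; $\mathcal F(N)$ is identified with its image. *)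

theory Defs
  imports "HOL-Analysis.Analysis"
begin

unbundle cardinal_syntax

section \<open>Density and \<open>\<kappa>\<close>-ideals\<close>

definition dense_span_in :: "'a::real_normed_vector set \<Rightarrow> 'a set \<Rightarrow> bool" where
  "dense_span_in A Z \<longleftrightarrow> A \<subseteq> Z \<and> Z \<subseteq> closure (span A)"

text \<open>Cardinals are cardinal orders, compared by \<open>\<le>o\<close> and \<open><o\<close>; the choice of a
  minimal spanning set only affects the value up to \<open>=o\<close>.\<close>

definition dens :: "'a::real_normed_vector set \<Rightarrow> 'a rel" where
  "dens Z = card_of (SOME A. dense_span_in A Z \<and> (\<forall>B. dense_span_in B Z \<longrightarrow> |A| \<le>o |B| ))"

lemma dens_attained: "\<exists>A. dense_span_in A Z \<and> dens Z = |A|"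
  and dens_least: "dense_span_in B Z \<Longrightarrow> dens Z \<le>o |B|"
proof -
  have "Z \<subseteq> closure (span Z)"
    by (meson closure_subset order_trans span_superset)
  then have "dense_span_in Z Z"
    by (simp add: dense_span_in_def)
  then have ne: "card_of ` {A. dense_span_in A Z} \<noteq> {}"
    by blast
  have co: "\<forall>r\<in>card_of ` {A. dense_span_in A Z}. Card_order r"
    by (auto simp: card_of_Card_order)
  have "\<exists>A. dense_span_in A Z \<and> (\<forall>B. dense_span_in B Z \<longrightarrow> |A| \<le>o |B| )"
    using exists_minim_Card_order[OF ne co] by blast
  from someI_ex[OF this]
  show "\<exists>A. dense_span_in A Z \<and> dens Z = |A|"
    and "dense_span_in B Z \<Longrightarrow> dens Z \<le>o |B|"
    unfolding dens_def by blast+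
qed

text \<open>Operators on a subspace \<open>E\<close> are functions on the ambient type whose values outside
  \<open>E\<close> are irrelevant, so linearity is relativised to \<open>E\<close>.\<close>

definition linear_operator_on ::
    "'a::real_vector set \<Rightarrow> 'b::real_vector set \<Rightarrow> ('a \<Rightarrow> 'b) \<Rightarrow> bool" where
  "linear_operator_on E Y P \<longleftrightarrow>
     P ` E \<subseteq> Y \<and>
     (\<forall>x\<in>E. \<forall>y\<in>E. P (x + y) = P x + P y) \<and>
     (\<forall>c. \<forall>x\<in>E. P (c *\<^sub>R x) = c *\<^sub>R P x)"

definition kappa_ideal ::
    "'k rel \<Rightarrow> 'a::real_normed_vector set \<Rightarrow> 'a set \<Rightarrow> bool" where
  "kappa_ideal \<kappa> Y W \<longleftrightarrow>
     subspace Y \<and> Y \<subseteq> W \<and>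
     (\<forall>E. subspace E \<and> E \<subseteq> W \<and> dens E <o \<kappa> \<longrightarrow>
        (\<exists>P. linear_operator_on E Y P \<and> (\<forall>e\<in>E. norm (P e) \<le> norm e) \<and>
             (\<forall>e\<in>E \<inter> Y. P e = e)))"


section \<open>The space of Lipschitz functions vanishing at the distinguished point\<close>

typedef (overloaded) 'a lip0 =
    "{f :: 'a::{metric_space,zero} \<Rightarrow> real. (\<exists>C. C-lipschitz_on UNIV f) \<and> f 0 = 0}"
  morphisms lip0_apply Lip0
  by (rule exI[of _ "\<lambda>_. 0"]) (auto intro: lipschitz_on_constant)

setup_lifting type_definition_lip0

instantiation lip0 :: ("{metric_space,zero}") real_normed_vector
begin

lift_definition zero_lip0 :: "'a lip0" is "\<lambda>_. 0"
  by (auto intro: lipschitz_on_constant)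

lift_definition plus_lip0 :: "'a lip0 \<Rightarrow> 'a lip0 \<Rightarrow> 'a lip0" is "\<lambda>f g x. f x + g x"
  by (auto intro: lipschitz_on_add)

lift_definition uminus_lip0 :: "'a lip0 \<Rightarrow> 'a lip0" is "\<lambda>f x. - f x"
  by (auto intro: lipschitz_on_minus)

lift_definition minus_lip0 :: "'a lip0 \<Rightarrow> 'a lip0 \<Rightarrow> 'a lip0" is "\<lambda>f g x. f x - g x"
  by (auto intro: lipschitz_on_diff)

lift_definition scaleR_lip0 :: "real \<Rightarrow> 'a lip0 \<Rightarrow> 'a lip0" is "\<lambda>c f x. c * f x"
  by (auto intro: lipschitz_on_cmult_real)

definition norm_lip0 :: "'a lip0 \<Rightarrow> real" where
  "norm_lip0 f = Inf {C. C-lipschitz_on UNIV (lip0_apply f)}"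

definition dist_lip0 :: "'a lip0 \<Rightarrow> 'a lip0 \<Rightarrow> real" where
  "dist_lip0 f g = norm (f - g)"

definition sgn_lip0 :: "'a lip0 \<Rightarrow> 'a lip0" where
  "sgn_lip0 f = inverse (norm f) *\<^sub>R f"

definition uniformity_lip0 :: "('a lip0 \<times> 'a lip0) filter" where
  "uniformity_lip0 = (INF e\<in>{0<..}. principal {(f :: 'a lip0, g). dist f g < e})"

definition open_lip0 :: "'a lip0 set \<Rightarrow> bool" where
  "open_lip0 U \<longleftrightarrow> (\<forall>f\<in>U. eventually (\<lambda>(f', g). f' = f \<longrightarrow> g \<in> U) uniformity)"

lemma norm_lip0_aux:
  fixes f :: "'a lip0"
  shows "(norm f)-lipschitz_on UNIV (lip0_apply f)"
    and "C-lipschitz_on UNIV (lip0_apply f) \<Longrightarrow> norm f \<le> C"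
proof -
  let ?S = "{C. C-lipschitz_on UNIV (lip0_apply f)}"
  have ne: "?S \<noteq> {}" using lip0_apply[of f] by auto
  have bdd: "bdd_below ?S" by (rule bdd_belowI[of _ 0]) (auto dest: lipschitz_on_nonneg)
  show *: "norm f \<le> C" if "C-lipschitz_on UNIV (lip0_apply f)" for C
    unfolding norm_lip0_def using that by (intro cInf_lower bdd) auto
  have "dist (lip0_apply f x) (lip0_apply f y) \<le> norm f * dist x y" for x y
  proof (cases "x = y")
    case False
    then have "dist (lip0_apply f x) (lip0_apply f y) / dist x y \<le> norm f"
      unfolding norm_lip0_def
      by (intro cInf_greatest ne) (auto simp: divide_simps dest: lipschitz_onD)
    with False show ?thesis by (simp add: divide_simps)
  qed auto
  moreover have "0 \<le> norm f"
    unfolding norm_lip0_def by (intro cInf_greatest ne) (auto dest: lipschitz_on_nonneg)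
  ultimately show "(norm f)-lipschitz_on UNIV (lip0_apply f)"
    by (intro lipschitz_onI) auto
qed

instance
proof
  fix f g :: "'a lip0" and a b :: real
  show "f + g + h = f + (g + h)" for h :: "'a lip0" by transfer (simp add: algebra_simps)
  show "f + g = g + f" by transfer (simp add: algebra_simps)
  show "0 + f = f" by transfer simp
  show "- f + f = 0" by transfer simp
  show "f - g = f + - g" by transfer simp
  show "a *\<^sub>R (f + g) = a *\<^sub>R f + a *\<^sub>R g" by transfer (simp add: algebra_simps)
  show "(a + b) *\<^sub>R f = a *\<^sub>R f + b *\<^sub>R f" by transfer (simp add: algebra_simps)
  show "a *\<^sub>R b *\<^sub>R f = (a * b) *\<^sub>R f" by transfer (simp add: algebra_simps)
  show "1 *\<^sub>R f = f" by transfer simp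
  show "dist f g = norm (f - g)" by (rule dist_lip0_def)
  show "sgn f = inverse (norm f) *\<^sub>R f" by (rule sgn_lip0_def)
  show "uniformity = (INF e\<in>{0<..}. principal {(f :: 'a lip0, g). dist f g < e})"
    by (rule uniformity_lip0_def)
  show "open U \<longleftrightarrow> (\<forall>f\<in>U. \<forall>\<^sub>F (f', g) in uniformity. f' = f \<longrightarrow> g \<in> U)" for U :: "'a lip0 set"
    by (rule open_lip0_def)
  have nonneg: "0 \<le> norm f" for f :: "'a lip0"
    by (rule lipschitz_on_nonneg[OF norm_lip0_aux(1)])
  show "norm f = 0 \<longleftrightarrow> f = 0"
  proof
    assume "norm f = 0"
    then have "lip0_apply f x = lip0_apply f 0" for x
      using lipschitz_onD[OF norm_lip0_aux(1)[of f], of x 0] by simp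
    then have "lip0_apply f x = 0" for x
      using lip0_apply[of f] by auto
    then show "f = 0" by transfer auto
  next
    assume "f = 0"
    then have "0-lipschitz_on UNIV (lip0_apply f)"
      by (simp add: zero_lip0.rep_eq lipschitz_on_constant)
    then show "norm f = 0" using norm_lip0_aux(2) nonneg by (meson order_antisym)
  qed
  show "norm (f + g) \<le> norm f + norm g"
    by (rule norm_lip0_aux(2))
       (simp add: plus_lip0.rep_eq lipschitz_on_add norm_lip0_aux(1))
  have le: "norm (a *\<^sub>R f) \<le> \<bar>a\<bar> * norm f" for a and f :: "'a lip0"
    by (rule norm_lip0_aux(2))
       (simp add: scaleR_lip0.rep_eq lipschitz_on_cmult_real norm_lip0_aux(1))
  show "norm (a *\<^sub>R f) = \<bar>a\<bar> * norm f"
  proof (cases "a = 0")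
    case True
    then show ?thesis using le[of 0 f] nonneg[of "0 *\<^sub>R f"] by simp
  next
    case False
    have "inverse a *\<^sub>R a *\<^sub>R f = f" using False by transfer (simp add: fun_eq_iff)
    then have "norm f \<le> \<bar>inverse a\<bar> * norm (a *\<^sub>R f)"
      using le[of "inverse a" "a *\<^sub>R f"] by simp
    with False have "\<bar>a\<bar> * norm f \<le> norm (a *\<^sub>R f)" by (simp add: field_simps)
    with le show ?thesis by (meson order_antisym)
  qed
qed

end

section \<open>Lipschitz-free spaces\<close>

definition delta :: "'a::{metric_space,zero} \<Rightarrow> 'a lip0 \<Rightarrow>\<^sub>L real" where
  "delta x = Blinfun (\<lambda>f. lip0_apply f x)"

definition free_space :: "('a::{metric_space,zero} lip0 \<Rightarrow>\<^sub>L real) set" where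
  "free_space = closure (span (range delta))"

lemma abs_lip0_apply_diff_le: "\<bar>lip0_apply f x - lip0_apply f y\<bar> \<le> norm f * dist x y"
  using lipschitz_onD[OF norm_lip0_aux(1)[of f], of x y] by (simp add: dist_real_def)

lemma lip0_apply_0 [simp]: "lip0_apply f 0 = 0"
  using lip0_apply[of f] by auto

lemma delta_apply [simp]: "blinfun_apply (delta x) f = lip0_apply f x"
proof -
  have "bounded_linear (\<lambda>f. lip0_apply f x)"
  proof (rule bounded_linear_intro)
    show "norm (lip0_apply f x) \<le> norm f * dist x 0" for f
      using abs_lip0_apply_diff_le[of f x 0] by simp
  qed (simp_all add: plus_lip0.rep_eq scaleR_lip0.rep_eq)
  then show ?thesis by (simp add: delta_def bounded_linear_Blinfun_apply)
qed

text \<open>The inclusion \<open>N \<subseteq> M\<close> of pointed metric spaces is a map \<open>i\<close> between types which preserves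
  distances and the distinguished point. The induced map of free spaces is precomposition with
  the restriction of Lipschitz functions from \<open>M\<close> to \<open>N\<close>. The lemmas below show that it is
  isometric and, on \<open>free_space\<close>, the only continuous linear map that sends \<open>delta x\<close> to
  \<open>delta (i x)\<close>.\<close>

definition lip0_restrict ::
    "('a::{metric_space,zero} \<Rightarrow> 'b::{metric_space,zero}) \<Rightarrow> 'b lip0 \<Rightarrow> 'a lip0" where
  "lip0_restrict i f = Lip0 (\<lambda>x. lip0_apply f (i x))"

definition free_inclusion ::
    "('a::{metric_space,zero} \<Rightarrow> 'b::{metric_space,zero}) \<Rightarrow>
     ('a lip0 \<Rightarrow>\<^sub>L real) \<Rightarrow> ('b lip0 \<Rightarrow>\<^sub>L real)" where
  "free_inclusion i \<mu> = Blinfun (\<lambda>f. blinfun_apply \<mu> (lip0_restrict i f))"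

context
  fixes i :: "'a::{metric_space,zero} \<Rightarrow> 'b::{metric_space,zero}"
  assumes dist_i: "\<And>x y. dist (i x) (i y) = dist x y" and i_0: "i 0 = 0"
begin

lemma lip0_restrict_lipschitz: "(norm f)-lipschitz_on UNIV (\<lambda>x. lip0_apply f (i x))"
proof (rule lipschitz_onI)
  show "dist (lip0_apply f (i x)) (lip0_apply f (i y)) \<le> norm f * dist x y" for x y
    using abs_lip0_apply_diff_le[of f "i x" "i y"] by (simp add: dist_i dist_real_def)
qed simp

lemma lip0_apply_restrict: "lip0_apply (lip0_restrict i f) x = lip0_apply f (i x)"
proof -
  have "(\<lambda>x. lip0_apply f (i x)) \<in> {f. (\<exists>C. C-lipschitz_on UNIV f) \<and> f 0 = 0}"
    using lip0_restrict_lipschitz[of f] i_0 by auto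
  then show ?thesis by (simp add: lip0_restrict_def Lip0_inverse)
qed

lemma norm_lip0_restrict_le: "norm (lip0_restrict i f) \<le> norm f"
  by (rule norm_lip0_aux(2)) (simp add: lip0_apply_restrict lip0_restrict_lipschitz)

lemma bounded_linear_lip0_restrict: "bounded_linear (lip0_restrict i)"
proof (rule bounded_linear_intro)
  show "norm (lip0_restrict i f) \<le> norm f * 1" for f
    using norm_lip0_restrict_le by simp
qed (auto intro!: lip0_apply_inject[THEN iffD1]
          simp: fun_eq_iff lip0_apply_restrict plus_lip0.rep_eq scaleR_lip0.rep_eq)

lemma free_inclusion_apply:
  "blinfun_apply (free_inclusion i \<mu>) f = blinfun_apply \<mu> (lip0_restrict i f)"
proof -
  have "bounded_linear (\<lambda>f. blinfun_apply \<mu> (lip0_restrict i f))"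
    by (rule bounded_linear_compose[OF blinfun.bounded_linear_right bounded_linear_lip0_restrict])
  then show ?thesis by (simp add: free_inclusion_def bounded_linear_Blinfun_apply)
qed

lemma free_inclusion_delta: "free_inclusion i (delta x) = delta (i x)"
  by (rule blinfun_eqI) (simp add: free_inclusion_apply lip0_apply_restrict)

lemma linear_free_inclusion: "linear (free_inclusion i)"
  by (rule linearI; rule blinfun_eqI)
     (simp_all add: free_inclusion_apply blinfun.add_left blinfun.scaleR_left)

text \<open>McShane extension.\<close>

lemma lip0_extend: "\<exists>g. lip0_restrict i g = f \<and> norm g \<le> norm f"
proof -
  define G where "G y = (INF x. lip0_apply f x + norm f * dist y (i x))" for y
  have lower: "lip0_apply f x' - norm f * dist y (i x') \<le> lip0_apply f x + norm f * dist y (i x)"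
    for x x' y
  proof -
    have "lip0_apply f x' - lip0_apply f x \<le> norm f * dist (i x') (i x)"
      using abs_lip0_apply_diff_le[of f x' x] by (simp add: dist_i)
    also have "\<dots> \<le> norm f * (dist y (i x') + dist y (i x))"
      by (intro mult_left_mono dist_triangle3) simp
    finally show ?thesis by (simp add: algebra_simps)
  qed
  have bdd: "bdd_below (range (\<lambda>x. lip0_apply f x + norm f * dist y (i x)))" for y
    by (rule bdd_belowI[of _ "lip0_apply f 0 - norm f * dist y (i 0)"]) (use lower in blast)
  have G_i: "G (i x) = lip0_apply f x" for x
  proof (rule antisym)
    have "G (i x) \<le> lip0_apply f x + norm f * dist (i x) (i x)"
      unfolding G_def by (rule cINF_lower[OF bdd]) simp
    then show "G (i x) \<le> lip0_apply f x" by simp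
    show "lip0_apply f x \<le> G (i x)"
      unfolding G_def by (rule cINF_greatest) (use lower[of x "i x"] in auto)
  qed
  have step: "G y \<le> G z + norm f * dist y z" for y z
  proof -
    have "G y - norm f * dist y z \<le> lip0_apply f x + norm f * dist z (i x)" for x
    proof -
      have "G y \<le> lip0_apply f x + norm f * dist y (i x)"
        unfolding G_def by (rule cINF_lower[OF bdd]) simp
      moreover have "norm f * dist y (i x) \<le> norm f * (dist y z + dist z (i x))"
        by (intro mult_left_mono dist_triangle) simp
      ultimately show ?thesis by (simp add: algebra_simps)
    qed
    then have "G y - norm f * dist y z \<le> G z"
      unfolding G_def[of z] by (intro cINF_greatest) auto
    then show ?thesis by simp
  qed
  have lip: "(norm f)-lipschitz_on UNIV G"
  proof (rule lipschitz_onI)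
    show "dist (G y) (G z) \<le> norm f * dist y z" for y z
      using step[of y z] step[of z y] by (simp add: dist_real_def dist_commute abs_le_iff)
  qed simp
  moreover have "G 0 = 0" using G_i[of 0] by (simp add: i_0)
  ultimately have rep: "lip0_apply (Lip0 G) = G"
    by (intro Lip0_inverse) auto
  have "lip0_restrict i (Lip0 G) = f"
    by (rule lip0_apply_inject[THEN iffD1]) (simp add: fun_eq_iff lip0_apply_restrict rep G_i)
  moreover have "norm (Lip0 G) \<le> norm f"
    by (rule norm_lip0_aux(2)) (simp add: rep lip)
  ultimately show ?thesis by blast
qed

lemma norm_free_inclusion: "norm (free_inclusion i \<mu>) = norm \<mu>"
proof (rule antisym)
  show "norm (free_inclusion i \<mu>) \<le> norm \<mu>"
  proof (rule norm_blinfun_bound)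
    show "norm (blinfun_apply (free_inclusion i \<mu>) f) \<le> norm \<mu> * norm f" for f
      unfolding free_inclusion_apply
      by (rule order_trans[OF norm_blinfun mult_left_mono[OF norm_lip0_restrict_le]]) simp
  qed simp
  show "norm \<mu> \<le> norm (free_inclusion i \<mu>)"
  proof (rule norm_blinfun_bound)
    fix f
    obtain g where g: "lip0_restrict i g = f" "norm g \<le> norm f" using lip0_extend by blast
    have "norm (blinfun_apply \<mu> f) = norm (blinfun_apply (free_inclusion i \<mu>) g)"
      by (simp add: free_inclusion_apply g)
    also have "\<dots> \<le> norm (free_inclusion i \<mu>) * norm g" by (rule norm_blinfun)
    also have "\<dots> \<le> norm (free_inclusion i \<mu>) * norm f" by (rule mult_left_mono[OF g(2)]) simp
    finally show "norm (blinfun_apply \<mu> f) \<le> norm (free_inclusion i \<mu>) * norm f" .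
  qed simp
qed

lemma free_inclusion_unique:
  assumes J: "linear_operator_on free_space UNIV J" "continuous_on free_space J"
    and J_delta: "\<And>x. J (delta x) = delta (i x)"
    and \<mu>: "\<mu> \<in> free_space"
  shows "J \<mu> = free_inclusion i \<mu>"
proof -
  have sub: "span (range delta) \<subseteq> (free_space :: ('a lip0 \<Rightarrow>\<^sub>L real) set)"
    unfolding free_space_def by (rule closure_subset)
  have on_span: "\<nu> \<in> span (range delta) \<and> J \<nu> = free_inclusion i \<nu>"
    if "\<nu> \<in> span (range delta)" for \<nu>
    using that
  proof (induction rule: span_induct_alt)
    case base
    have "J (0 *\<^sub>R 0) = 0 *\<^sub>R J 0"
      using J(1) sub span_zero unfolding linear_operator_on_def by blast
    then have "J 0 = free_inclusion i 0"
      by (simp only: scaleR_zero_left linear_0[OF linear_free_inclusion])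
    then show ?case using span_zero by blast
  next
    case (step c x y)
    then obtain z where z: "x = delta z" by blast
    have in_span: "x \<in> span (range delta)" "c *\<^sub>R x \<in> span (range delta)" "y \<in> span (range delta)"
      using step by (simp_all add: span_base span_scale)
    then have "J (c *\<^sub>R x + y) = J (c *\<^sub>R x) + J y" "J (c *\<^sub>R x) = c *\<^sub>R J x"
      using J(1) subsetD[OF sub] unfolding linear_operator_on_def by blast+
    moreover have "J x = free_inclusion i x"
      unfolding z J_delta free_inclusion_delta ..
    moreover have "J y = free_inclusion i y"
      using step by blast
    ultimately have "J (c *\<^sub>R x + y) = free_inclusion i (c *\<^sub>R x + y)"
      by (simp only: linear_add[OF linear_free_inclusion] linear_scale[OF linear_free_inclusion])
    then show ?case
      using span_add[OF in_span(2,3)] by blast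
  qed
  have bl: "bounded_linear (free_inclusion i)"
    using linear_free_inclusion norm_free_inclusion
    by (auto intro!: bounded_linear.intro bounded_linear_axioms.intro exI[of _ 1])
  have "continuous_on free_space (\<lambda>\<nu>. J \<nu> - free_inclusion i \<nu>)"
    by (intro continuous_on_diff J(2) linear_continuous_on bl)
  then have "J \<mu> - free_inclusion i \<mu> = 0"
    unfolding free_space_def
    by (rule continuous_constant_on_closure)
       (use \<mu> on_span[THEN conjunct2] in \<open>simp_all add: free_space_def\<close>)
  then show ?thesis by simp
qed

end

end

theory Submission
  imports Defs
begin

text \<open>
  A contraction \<open>q\<close> to \<open>N\<close> from a subset \<open>G\<close> of \<open>M\<close> containing \<open>0\<close>, with \<open>q 0 = 0\<close> induces a linear contraction from the
  closed span of \<open>delta ` G\<close> to the free space of \<open>N\<close> that sends \<open>delta x\<close> to \<open>delta (q x)\<close>. It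
  remains to reduce a given subspace \<open>E\<close> of the free space of \<open>M\<close> to a subspace \<open>G\<close> of \<open>M\<close> of
  density below \<open>\<kappa>\<close>, to which the hypothesis on \<open>N\<close> applies.

  For this, \<open>G\<close> must satisfy two conditions. First, \<open>E\<close> must lie in the closed span of \<open>delta ` G\<close>.
  Every element of a closed span of deltas is a limit of combinations of countably many of them, so
  a set \<open>A\<close> that spans a dense subspace of \<open>E\<close> is supported on a set \<open>T\<close> of
  cardinality at most \<open>|A| + \<aleph>\<^sub>0\<close> (\<open>small_support\<close>); this is below \<open>\<kappa>\<close> because \<open>\<kappa>\<close> is uncountable.
  Second, the operator must fix \<open>E \<inter> \<F>(N)\<close>. It fixes \<open>delta x\<close> for \<open>x\<close> in \<open>G \<inter> N\<close>, so it suffices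
  that \<open>E \<inter> \<F>(N)\<close> lies in the closed span of the deltas at points of \<open>G \<inter> N\<close>. This does not follow
  from the first condition, but density character is inherited by subsets of metric spaces: the
  rational combinations of \<open>A\<close> are dense in \<open>E\<close>, so some set \<open>C \<subseteq> \<F>(N)\<close> of cardinality at
  most \<open>|A| + \<aleph>\<^sub>0\<close> has \<open>E \<inter> \<F>(N)\<close> in its closure (\<open>small_dense_subset\<close>). The set \<open>C\<close> is
  supported on a small set \<open>S \<subseteq> N\<close>, and \<open>G\<close> is the span of \<open>S \<union> T\<close>.
\<close>

section \<open>Cardinal bounds for dense and supporting sets\<close>

text \<open>The levels are indexed by the number of summands, so that each level is an image of a product
  of sets whose cardinality is already bounded.\<close>

primrec rational_combinations :: "'a::real_vector set \<Rightarrow> nat \<Rightarrow> 'a set" where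
  "rational_combinations A 0 = {0}"
| "rational_combinations A (Suc n) =
     (\<lambda>(q, a, x). q *\<^sub>R a + x) ` (\<rat> \<times> A \<times> rational_combinations A n)"

lemma card_finite_le_infinite:
  assumes "finite F" "infinite B"
  shows "|F| \<le>o |B|"
  using assms
  by (meson finite_iff_ordLess_natLeq infinite_iff_natLeq_ordLeq ordLess_imp_ordLeq ordLeq_transitive)

lemma card_Times_nat_le:
  assumes "infinite B" "|C| \<le>o |B|"
  shows "|C \<times> (UNIV :: nat set)| \<le>o |B|"
  using assms by (simp add: card_of_Sigma_ordLeq_infinite infinite_iff_card_of_nat[symmetric])

lemma card_rational_combinations_le:
  assumes "infinite B" "|A| \<le>o |B|"
  shows "|rational_combinations A n| \<le>o |B|"
proof (induction n)
  case 0
  show ?case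
    using assms(1) by (simp add: card_finite_le_infinite)
next
  case (Suc n)
  have "|\<rat> :: real set| \<le>o |UNIV :: nat set|"
    using countable_rat unfolding countable_def by (auto simp flip: card_of_ordLeq)
  then have "|\<rat> :: real set| \<le>o |B|"
    using assms(1) by (meson infinite_iff_card_of_nat ordLeq_transitive)
  then have "|(\<rat> :: real set) \<times> A \<times> rational_combinations A n| \<le>o |B|"
    using assms Suc by (simp add: card_of_Sigma_ordLeq_infinite)
  then show ?case
    unfolding rational_combinations.simps by (rule ordLeq_transitive[OF card_of_image])
qed

text \<open>The closure of the rational combinations absorbs \<open>c *\<^sub>R a + x\<close> for real \<open>c\<close>, because \<open>c\<close> and
  \<open>x\<close> can be approximated independently; hence induction over the span applies.\<close>

lemma span_subset_closure_rational_combinations: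
  fixes A :: "'a::real_normed_vector set"
  shows "span A \<subseteq> closure (\<Union>n. rational_combinations A n)"
proof
  let ?U = "\<Union>n. rational_combinations A n"
  fix x assume "x \<in> span A"
  then show "x \<in> closure ?U"
  proof (induction rule: span_induct_alt)
    case base
    have "0 \<in> ?U" by (rule UN_I[of 0]) simp_all
    then show ?case by (rule closure_subset[THEN subsetD])
  next
    case (step c a x)
    obtain y where y: "\<And>n. y n \<in> ?U" "y \<longlonglongrightarrow> x"
      using step.IH unfolding closure_sequential by blast
    have "c \<in> closure \<rat>" by (simp add: Rats_closure_real)
    then obtain q where q: "\<And>n. q n \<in> \<rat>" "q \<longlonglongrightarrow> c"
      unfolding closure_sequential by blast
    have "q n *\<^sub>R a + y n \<in> ?U" for n
    proof -
      obtain m where "y n \<in> rational_combinations A m" using y(1) by blast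
      then have "q n *\<^sub>R a + y n \<in> rational_combinations A (Suc m)"
        using q(1)[of n] step.hyps
        unfolding rational_combinations.simps by (intro image_eqI[of _ _ "(q n, a, y n)"]) auto
      then show ?thesis by blast
    qed
    moreover have "(\<lambda>n. q n *\<^sub>R a + y n) \<longlonglongrightarrow> c *\<^sub>R a + x"
      by (rule tendsto_add[OF tendsto_scaleR[OF q(2) tendsto_const] y(2)])
    ultimately show ?case
      unfolding closure_sequential by (intro exI[of _ "\<lambda>n. q n *\<^sub>R a + y n"] conjI allI)
  qed
qed

lemma small_dense_set_of_closure_span:
  fixes A :: "'a::real_normed_vector set"
  assumes "infinite B" "|A| \<le>o |B|"
  obtains D where "|D| \<le>o |B|" "closure (span A) \<subseteq> closure D"
proof
  show "|\<Union>n. rational_combinations A n| \<le>o |B|"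
    using assms(1) card_rational_combinations_le[OF assms]
    by (intro card_of_UNION_ordLeq_infinite) (simp_all flip: infinite_iff_card_of_nat)
  show "closure (span A) \<subseteq> closure (\<Union>n. rational_combinations A n)"
    by (simp add: closure_minimal span_subset_closure_rational_combinations)
qed

text \<open>Hereditary density in metric spaces: each pair of a point of \<open>D\<close> and a radius \<open>1/(n+1)\<close>
  contributes one point of \<open>Y\<close> within that radius, if there is any.\<close>

lemma small_dense_subset:
  fixes D Y :: "'a::metric_space set"
  assumes "infinite B" "|D| \<le>o |B|"
  obtains C where "C \<subseteq> Y" "|C| \<le>o |B|" "closure D \<inter> Y \<subseteq> closure C"
proof -
  define near where "near d n y \<longleftrightarrow> y \<in> Y \<and> dist y d < inverse (real (Suc n))" for d n y
  define I where "I = {(d, n). d \<in> D \<and> (\<exists>y. near d n y)}"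
  define C where "C = (\<lambda>(d, n). SOME y. near d n y) ` I"
  have near: "near d n (SOME y. near d n y)" if "(d, n) \<in> I" for d n
    using that unfolding I_def by (auto intro: someI_ex)
  show thesis
  proof
    show "C \<subseteq> Y" using near by (auto simp: C_def near_def)
    have "|I| \<le>o |D \<times> (UNIV :: nat set)|"
      by (rule card_of_mono1) (auto simp: I_def)
    then show "|C| \<le>o |B|"
      unfolding C_def
      using card_Times_nat_le[OF assms] by (blast intro: card_of_image ordLeq_transitive)
    show "closure D \<inter> Y \<subseteq> closure C"
    proof
      fix y assume y: "y \<in> closure D \<inter> Y"
      show "y \<in> closure C"
        unfolding closure_approachable
      proof (intro allI impI)
        fix e :: real assume "0 < e"
        then obtain n where n: "inverse (real (Suc n)) < e / 2"
          using reals_Archimedean[of "e / 2"] by auto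
        obtain d where d: "d \<in> D" "dist d y < inverse (real (Suc n))"
          using closure_approachableD[of y D "inverse (real (Suc n))"] y
          by (auto simp: dist_commute)
        have I: "(d, n) \<in> I"
          using d y by (auto simp: I_def near_def dist_commute)
        let ?z = "SOME y. near d n y"
        have "dist ?z y \<le> dist ?z d + dist d y" by (rule dist_triangle)
        also have "\<dots> < e"
          using near[OF I] d n unfolding near_def by linarith
        finally show "\<exists>z\<in>C. dist z y < e"
          using I unfolding C_def by force
      qed
    qed
  qed
qed

text \<open>Each point of \<open>C\<close> has, for every \<open>n\<close>, an approximation up to \<open>1/(n+1)\<close> that uses only finitely
  many generators. Collecting these gives countably many generators for each point.\<close>

lemma small_support:
  fixes f :: "'a \<Rightarrow> 'b::real_normed_vector"
  assumes "infinite B" "|C| \<le>o |B|" "C \<subseteq> closure (span (f ` T))"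
  obtains S where "S \<subseteq> T" "|S| \<le>o |B|" "C \<subseteq> closure (span (f ` S))"
proof -
  have "\<exists>K. finite K \<and> K \<subseteq> T \<and> (\<exists>y\<in>span (f ` K). dist y x < inverse (real (Suc n)))"
    if x: "x \<in> C" for x n
  proof -
    obtain y where y: "y \<in> span (f ` T)" "dist y x < inverse (real (Suc n))"
      using closure_approachableD[OF subsetD[OF assms(3) x], of "inverse (real (Suc n))"]
      by (auto simp: dist_commute)
    obtain F where F: "finite F" "F \<subseteq> f ` T" "y \<in> span F"
      using y(1) unfolding span_explicit
      by (smt (verit) mem_Collect_eq span_base span_scale span_sum subset_iff)
    obtain K where "K \<subseteq> T" "finite K" "F = f ` K"
      using F finite_subset_image by metis
    with F y show ?thesis by blast
  qed
  then obtain K where K: "\<And>x n. x \<in> C \<Longrightarrow> finite (K x n)" "\<And>x n. x \<in> C \<Longrightarrow> K x n \<subseteq> T"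
      "\<And>x n. x \<in> C \<Longrightarrow> \<exists>y\<in>span (f ` K x n). dist y x < inverse (real (Suc n))"
    by metis
  define S where "S = (\<Union>(x, n)\<in>C \<times> UNIV. K x n)"
  show thesis
  proof
    show "S \<subseteq> T" using K(2) by (auto simp: S_def)
    show "|S| \<le>o |B|"
      unfolding S_def
    proof (rule card_of_UNION_ordLeq_infinite[OF assms(1) card_Times_nat_le[OF assms(1,2)]], safe)
      fix x n assume "x \<in> C"
      then show "|K x n| \<le>o |B|"
        using K(1) assms(1) by (simp add: card_finite_le_infinite)
    qed
    show "C \<subseteq> closure (span (f ` S))"
    proof
      fix x assume x: "x \<in> C"
      show "x \<in> closure (span (f ` S))"
        unfolding closure_approachable
      proof (intro allI impI)
        fix e :: real assume "0 < e"
        then obtain n where n: "inverse (real (Suc n)) < e"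
          using reals_Archimedean[of e] by auto
        obtain y where y: "y \<in> span (f ` K x n)" "dist y x < inverse (real (Suc n))"
          using K(3) x by blast
        have "f ` K x n \<subseteq> f ` S" using x by (force simp: S_def)
        then have "y \<in> span (f ` S)" using y(1) span_mono by blast
        then show "\<exists>y\<in>span (f ` S). dist y x < e" using y(2) n by force
      qed
    qed
  qed
qed

section \<open>Push-forward along a contraction of a subset\<close>

lemma closure_span_minimal:
  fixes V :: "'a::real_normed_vector set"
  assumes "A \<subseteq> V" "subspace V" "closed V"
  shows "closure (span A) \<subseteq> V"
  using assms by (simp add: closure_minimal span_minimal)

lemma subspace_closure:
  fixes V :: "'a::real_normed_vector set"
  assumes "subspace V"
  shows "subspace (closure V)"
proof (rule subspaceI)
  show "0 \<in> closure V"
    using subspace_0[OF assms] closure_subset by blast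
next
  fix x y assume "x \<in> closure V" "y \<in> closure V"
  then obtain f g where "\<And>n. f n \<in> V" "\<And>n. g n \<in> V" "f \<longlonglongrightarrow> x" "g \<longlonglongrightarrow> y"
    unfolding closure_sequential by blast
  then show "x + y \<in> closure V"
    unfolding closure_sequential
    by (intro exI[of _ "\<lambda>n. f n + g n"]) (simp add: subspace_add[OF assms] tendsto_add)
next
  fix c x assume "x \<in> closure V"
  then obtain f where "\<And>n. f n \<in> V" "f \<longlonglongrightarrow> x"
    unfolding closure_sequential by blast
  then show "c *\<^sub>R x \<in> closure V"
    unfolding closure_sequential
    by (intro exI[of _ "\<lambda>n. c *\<^sub>R f n"]) (simp add: subspace_scale[OF assms] tendsto_scaleR)
qed

text \<open>Elements of the closed span of \<open>delta ` S\<close> see only the values of a Lipschitz function on \<open>S\<close>.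
  This makes the push-forward below independent of the choice of extensions, and it is also how that
  operator is shown to fix the functionals supported on the fixed points of \<open>q\<close>.\<close>

lemma free_functional_cong:
  assumes "\<mu> \<in> closure (span (delta ` S))"
    and "\<And>x. x \<in> S \<Longrightarrow> lip0_apply g x = lip0_apply h x"
  shows "blinfun_apply \<mu> g = blinfun_apply \<mu> h"
proof -
  let ?V = "{\<mu>. blinfun_apply \<mu> g = blinfun_apply \<mu> h}"
  have "closure (span (delta ` S)) \<subseteq> ?V"
  proof (rule closure_span_minimal)
    show "delta ` S \<subseteq> ?V" using assms(2) by auto
    show "subspace ?V"
      by (rule subspaceI) (auto simp: blinfun.add_left blinfun.scaleR_left)
    show "closed ?V"
      by (intro closed_Collect_eq continuous_intros)
  qed
  with assms(1) show ?thesis by blast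
qed

text \<open>The set \<open>S\<close> is not a type of its own, so its free space is represented by the closed span of
  \<open>delta ` S\<close> inside the dual of the Lipschitz functions on the ambient space.\<close>

locale pointed_contraction =
  fixes S :: "'m::{metric_space,zero} set" and q :: "'m \<Rightarrow> 'n::{metric_space,zero}"
  assumes zero_mem: "0 \<in> S" and q_0: "q 0 = 0"
    and dist_q_le: "\<And>x y. x \<in> S \<Longrightarrow> y \<in> S \<Longrightarrow> dist (q x) (q y) \<le> dist x y"
begin

text \<open>McShane extension of \<open>f \<circ> q\<close> from \<open>S\<close>: the infimal convolution with \<open>norm f * dist\<close> keeps the
  Lipschitz constant, and it does not change the values on \<open>S\<close> because \<open>f \<circ> q\<close> already has that
  constant there.\<close>

lemma exists_extension:
  "\<exists>g. (\<forall>x\<in>S. lip0_apply g x = lip0_apply f (q x)) \<and> norm g \<le> norm f"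
proof -
  define h where "h x y = lip0_apply f (q x) + norm f * dist y x" for x y
  define G where "G y = (INF x\<in>S. h x y)" for y
  have h_step: "h x y \<le> h x z + norm f * dist y z" for x y z
  proof -
    have "norm f * dist y x \<le> norm f * (dist y z + dist z x)"
      by (intro mult_left_mono dist_triangle) simp
    then show ?thesis by (simp add: h_def algebra_simps)
  qed
  have value_le: "lip0_apply f (q z) \<le> h x z" if "x \<in> S" "z \<in> S" for x z
  proof -
    have "lip0_apply f (q z) - lip0_apply f (q x) \<le> norm f * dist (q z) (q x)"
      using abs_lip0_apply_diff_le[of f "q z" "q x"] by simp
    also have "\<dots> \<le> norm f * dist z x"
      using that by (intro mult_left_mono dist_q_le) auto
    finally show ?thesis by (simp add: h_def)
  qed
  have bdd: "bdd_below ((\<lambda>x. h x y) ` S)" for y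
  proof (rule bdd_belowI2)
    show "lip0_apply f (q 0) - norm f * dist 0 y \<le> h x y" if "x \<in> S" for x
      using value_le[OF that zero_mem] h_step[of x 0 y] by simp
  qed
  have G_S: "G x = lip0_apply f (q x)" if "x \<in> S" for x
  proof (rule antisym)
    have "G x \<le> h x x"
      unfolding G_def by (rule cINF_lower[OF bdd that])
    then show "G x \<le> lip0_apply f (q x)" by (simp add: h_def)
    show "lip0_apply f (q x) \<le> G x"
      unfolding G_def by (rule cINF_greatest) (use zero_mem value_le that in auto)
  qed
  have step: "G y \<le> G z + norm f * dist y z" for y z
  proof -
    have "G y - norm f * dist y z \<le> h x z" if "x \<in> S" for x
      using cINF_lower[OF bdd that, of y] h_step[of x y z] by (simp add: G_def)
    then have "G y - norm f * dist y z \<le> G z"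
      unfolding G_def[of z] using zero_mem by (intro cINF_greatest) auto
    then show ?thesis by simp
  qed
  have lip: "(norm f)-lipschitz_on UNIV G"
  proof (rule lipschitz_onI)
    show "dist (G y) (G z) \<le> norm f * dist y z" for y z
      using step[of y z] step[of z y] by (simp add: dist_real_def dist_commute abs_le_iff)
  qed simp
  moreover have "G 0 = 0" using G_S[OF zero_mem] by (simp add: q_0)
  ultimately have rep: "lip0_apply (Lip0 G) = G"
    by (intro Lip0_inverse) auto
  have "norm (Lip0 G) \<le> norm f"
    by (rule norm_lip0_aux(2)) (simp add: rep lip)
  then show ?thesis using rep G_S by metis
qed

definition extension :: "'n lip0 \<Rightarrow> 'm lip0" where
  "extension f = (SOME g. (\<forall>x\<in>S. lip0_apply g x = lip0_apply f (q x)) \<and> norm g \<le> norm f)"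

lemma extension_apply: "x \<in> S \<Longrightarrow> lip0_apply (extension f) x = lip0_apply f (q x)"
  and norm_extension_le: "norm (extension f) \<le> norm f"
  using someI_ex[OF exists_extension[of f]] unfolding extension_def by blast+

text \<open>This is precomposition with \<open>f \<mapsto> f \<circ> q\<close>. The chosen extension of \<open>f \<circ> q\<close> need not depend linearly
  on \<open>f\<close>, so the formula defines a bounded functional only for \<open>\<mu>\<close> in the closed span of
  \<open>delta ` S\<close>; elsewhere the value of \<open>Blinfun\<close> may be meaningless.\<close>

definition pushforward :: "('m lip0 \<Rightarrow>\<^sub>L real) \<Rightarrow> ('n lip0 \<Rightarrow>\<^sub>L real)" where
  "pushforward \<mu> = Blinfun (\<lambda>f. blinfun_apply \<mu> (extension f))"

context
  fixes \<mu> :: "'m lip0 \<Rightarrow>\<^sub>L real"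
  assumes \<mu>: "\<mu> \<in> closure (span (delta ` S))"
begin

lemma abs_apply_extension_le: "norm (blinfun_apply \<mu> (extension f)) \<le> norm \<mu> * norm f"
  by (rule order_trans[OF norm_blinfun mult_left_mono[OF norm_extension_le]]) simp

lemma pushforward_extension:
  "blinfun_apply (pushforward \<mu>) f = blinfun_apply \<mu> (extension f)"
proof -
  have "bounded_linear (\<lambda>f. blinfun_apply \<mu> (extension f))"
  proof (rule bounded_linear_intro)
    fix f g :: "'n lip0" and c :: real
    have "blinfun_apply \<mu> (extension (f + g)) = blinfun_apply \<mu> (extension f + extension g)"
      by (rule free_functional_cong[OF \<mu>]) (simp add: extension_apply plus_lip0.rep_eq)
    then show "blinfun_apply \<mu> (extension (f + g)) =
        blinfun_apply \<mu> (extension f) + blinfun_apply \<mu> (extension g)"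
      by (simp add: blinfun.add_right)
    have "blinfun_apply \<mu> (extension (c *\<^sub>R f)) = blinfun_apply \<mu> (c *\<^sub>R extension f)"
      by (rule free_functional_cong[OF \<mu>]) (simp add: extension_apply scaleR_lip0.rep_eq)
    then show "blinfun_apply \<mu> (extension (c *\<^sub>R f)) = c *\<^sub>R blinfun_apply \<mu> (extension f)"
      by (simp add: blinfun.scaleR_right)
    show "norm (blinfun_apply \<mu> (extension f)) \<le> norm f * norm \<mu>"
      using abs_apply_extension_le[of f] by (simp add: mult.commute)
  qed
  then show ?thesis by (simp add: pushforward_def bounded_linear_Blinfun_apply)
qed

lemma norm_pushforward_le: "norm (pushforward \<mu>) \<le> norm \<mu>"
  by (rule norm_blinfun_bound) (simp_all only: norm_ge_zero pushforward_extension abs_apply_extension_le)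

end

lemma closure_span_delta_subspace: "subspace (closure (span (delta ` S)))"
  by (simp add: subspace_closure)

lemma pushforward_add:
  assumes "\<mu> \<in> closure (span (delta ` S))" "\<nu> \<in> closure (span (delta ` S))"
  shows "pushforward (\<mu> + \<nu>) = pushforward \<mu> + pushforward \<nu>"
  using assms subspace_add[OF closure_span_delta_subspace assms]
  by (intro blinfun_eqI) (simp add: pushforward_extension blinfun.add_left)

lemma pushforward_scaleR:
  assumes "\<mu> \<in> closure (span (delta ` S))"
  shows "pushforward (c *\<^sub>R \<mu>) = c *\<^sub>R pushforward \<mu>"
  using assms subspace_scale[OF closure_span_delta_subspace assms]
  by (intro blinfun_eqI) (simp add: pushforward_extension blinfun.scaleR_left)

lemma pushforward_delta:
  assumes "x \<in> S"
  shows "pushforward (delta x) = delta (q x)"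
proof -
  have "delta x \<in> closure (span (delta ` S))"
    using assms by (intro closure_subset[THEN subsetD] span_base imageI)
  then show ?thesis
    using assms by (intro blinfun_eqI) (simp add: pushforward_extension extension_apply)
qed

text \<open>Combinations of deltas go to combinations of deltas, and a contraction preserves limits.\<close>

lemma pushforward_mem_free_space:
  assumes \<mu>: "\<mu> \<in> closure (span (delta ` S))"
  shows "pushforward \<mu> \<in> free_space"
proof -
  let ?Z = "closure (span (delta ` S))"
  have sub: "span (delta ` S) \<subseteq> ?Z" by (rule closure_subset)
  have on_span: "pushforward \<nu> \<in> span (range delta)" if "\<nu> \<in> span (delta ` S)" for \<nu>
  proof -
    have "\<nu> \<in> span (delta ` S) \<and> pushforward \<nu> \<in> span (range delta)"
      using that
    proof (induction rule: span_induct_alt)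
      case base
      have "pushforward (0 *\<^sub>R 0) = 0 *\<^sub>R pushforward 0"
        by (rule pushforward_scaleR) (use sub span_zero in blast)
      then show ?case by (simp add: span_zero)
    next
      case (step c x y)
      then obtain z where z: "z \<in> S" "x = delta z" by blast
      have in_span: "x \<in> span (delta ` S)" "c *\<^sub>R x \<in> span (delta ` S)"
        using step by (simp_all add: span_base span_scale)
      have "pushforward (c *\<^sub>R x + y) = c *\<^sub>R delta (q z) + pushforward y"
        using in_span step.IH sub z pushforward_delta
        by (simp add: pushforward_add pushforward_scaleR subset_iff)
      then show ?case
        using in_span step.IH by (simp add: span_add span_scale span_base)
    qed
    then show ?thesis by blast
  qed
  show ?thesis
    unfolding free_space_def closure_approachable
  proof (intro allI impI)
    fix e :: real assume "0 < e"
    then obtain \<nu> where \<nu>: "\<nu> \<in> span (delta ` S)" "dist \<nu> \<mu> < e"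
      using \<mu> unfolding closure_approachable by blast
    have "\<nu> \<in> ?Z" using \<nu> sub by blast
    then have "pushforward \<nu> = pushforward (\<nu> - \<mu>) + pushforward \<mu>"
      using pushforward_add[OF subspace_diff[OF closure_span_delta_subspace, of \<nu> \<mu>] \<mu>] \<mu> by simp
    then have "dist (pushforward \<nu>) (pushforward \<mu>) \<le> dist \<nu> \<mu>"
      using norm_pushforward_le[OF subspace_diff[OF closure_span_delta_subspace \<open>\<nu> \<in> ?Z\<close> \<mu>]]
      by (simp add: dist_norm)
    then show "\<exists>\<rho>\<in>span (range delta). dist \<rho> (pushforward \<mu>) < e"
      using on_span \<nu> by force
  qed
qed

end

section \<open>Inheritance of the ideal property\<close>

lemma free_inclusion_image_subset:
  fixes i :: "'a::{metric_space,zero} \<Rightarrow> 'b::{metric_space,zero}"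
  assumes dist_i: "\<And>x y. dist (i x) (i y) = dist x y" and i_0: "i 0 = 0"
  shows "free_inclusion i ` free_space \<subseteq> closure (span (delta ` range i))"
proof -
  have lin: "linear (free_inclusion i)"
    by (rule linear_free_inclusion[OF assms])
  have bl: "bounded_linear (free_inclusion i)"
    using lin norm_free_inclusion[OF assms]
    by (auto intro!: bounded_linear.intro bounded_linear_axioms.intro exI[of _ 1])
  have "free_inclusion i ` range delta = delta ` range i"
    by (simp add: image_image free_inclusion_delta[OF assms])
  then have "free_inclusion i ` span (range delta) = span (delta ` range i)"
    using linear_span_image[OF lin, of "range delta"] by simp
  then have "free_inclusion i ` span (range delta) \<subseteq> closure (span (delta ` range i))"
    using closure_subset by blast
  then show ?thesis
    unfolding free_space_def
    by (intro image_closure_subset linear_continuous_on[OF bl] closed_closure)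
qed

theorem proposition3p9:
  fixes \<kappa> :: "'k rel"
    and i :: "'n::banach \<Rightarrow> 'm::banach"
  assumes "Card_order \<kappa>" and "natLeq <o \<kappa>"
    and "linear i" and "\<And>x. norm (i x) = norm x"
    and "kappa_ideal \<kappa> (range i) UNIV"
  shows "kappa_ideal \<kappa> (free_inclusion i ` free_space) (free_space :: ('m lip0 \<Rightarrow>\<^sub>L real) set)"
proof -
  let ?Y = "free_inclusion i ` free_space :: ('m lip0 \<Rightarrow>\<^sub>L real) set"
  have dist_i: "dist (i x) (i y) = dist x y" for x y
    using assms(4)[of "x - y"] by (simp add: dist_norm linear_diff[OF assms(3)])
  have i_0: "i 0 = 0" by (rule linear_0[OF assms(3)])
  note incl = free_inclusion_image_subset[of i, OF dist_i i_0]
  have "subspace ?Y"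
    unfolding free_space_def
    by (rule linear_subspace_image[OF linear_free_inclusion[OF dist_i i_0]])
       (simp add: subspace_closure)
  moreover have "?Y \<subseteq> free_space"
    unfolding free_space_def
    by (rule order_trans[OF incl[unfolded free_space_def]])
       (intro closure_mono span_mono image_mono subset_UNIV)
  moreover have "\<exists>P. linear_operator_on E ?Y P \<and> (\<forall>e\<in>E. norm (P e) \<le> norm e) \<and>
      (\<forall>e\<in>E \<inter> ?Y. P e = e)"
    if E: "subspace E" "E \<subseteq> free_space" "dens E <o \<kappa>" for E
  proof -
    obtain A where A: "A \<subseteq> E" "E \<subseteq> closure (span A)" "dens E = |A|"
      using dens_attained[of E] unfolding dense_span_in_def by blast
    \<comment> \<open>The summand \<open>nat\<close> makes \<open>B\<close> infinite even if \<open>E\<close> has finite dimension; \<open>|B| <o \<kappa>\<close> still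
      holds because \<open>\<kappa>\<close> is uncountable.\<close>
    define B where "B = A <+> (UNIV :: nat set)"
    have infB: "infinite B" by (simp add: B_def)
    have AB: "|A| \<le>o |B|" unfolding B_def by (rule card_of_Plus1)
    have "natLeq \<le>o |Field \<kappa>|"
      using ordLess_imp_ordLeq[OF assms(2)] ordIso_symmetric[OF card_of_Field_ordIso[OF assms(1)]]
      by (rule ordLeq_ordIso_trans)
    then have inf\<kappa>: "infinite (Field \<kappa>)"
      using infinite_iff_natLeq_ordLeq by blast
    have B\<kappa>: "|B| <o \<kappa>"
      unfolding B_def
    proof (rule card_of_Plus_ordLess_infinite_Field[OF inf\<kappa> assms(1)])
      show "|A| <o \<kappa>" using A(3) E(3) by simp
      show "|UNIV :: nat set| <o \<kappa>" by (rule ordIso_ordLess_trans[OF card_of_nat assms(2)])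
    qed
    obtain D where D: "|D| \<le>o |B|" "closure (span A) \<subseteq> closure D"
      using small_dense_set_of_closure_span[OF infB AB] .
    obtain C where C: "C \<subseteq> ?Y" "|C| \<le>o |B|" "closure D \<inter> ?Y \<subseteq> closure C"
      using small_dense_subset[OF infB D(1)] .
    obtain S where S: "S \<subseteq> range i" "|S| \<le>o |B|" "C \<subseteq> closure (span (delta ` S))"
      using small_support[OF infB C(2) order_trans[OF C(1) incl]] .
    have "A \<subseteq> closure (span (range delta))"
      using order_trans[OF A(1) E(2)] unfolding free_space_def .
    from small_support[OF infB AB this]
    obtain T where T: "|T| \<le>o |B|" "A \<subseteq> closure (span (delta ` T))" .
    define G where "G = span (S \<union> T)"
    have "|S \<union> T| <o \<kappa>"
      by (intro card_of_Un_ordLess_infinite_Field[OF inf\<kappa> assms(1)]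
          ordLeq_ordLess_trans[OF S(2) B\<kappa>] ordLeq_ordLess_trans[OF T(1) B\<kappa>])
    moreover have "dens G \<le>o |S \<union> T|"
      unfolding G_def
      by (rule dens_least) (simp add: dense_span_in_def closure_subset span_superset)
    ultimately have "dens G <o \<kappa>" using ordLeq_ordLess_trans by blast
    moreover have subG: "subspace G" by (simp add: G_def)
    ultimately have "\<exists>Q. linear_operator_on G (range i) Q \<and> (\<forall>x\<in>G. norm (Q x) \<le> norm x) \<and>
        (\<forall>x\<in>G \<inter> range i. Q x = x)"
      using assms(5) unfolding kappa_ideal_def by simp
    then obtain Q where Q: "linear_operator_on G (range i) Q"
        "\<And>x. x \<in> G \<Longrightarrow> norm (Q x) \<le> norm x" "\<And>x. x \<in> G \<inter> range i \<Longrightarrow> Q x = x"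
      by blast
    \<comment> \<open>\<open>Q\<close> takes values in the copy \<open>range i\<close> of the smaller space; \<open>q\<close> is the same map with values
      in that space itself.\<close>
    define q where "q x = inv i (Q x)" for x
    have iq: "i (q x) = Q x" if "x \<in> G" for x
      using Q(1) that unfolding linear_operator_on_def q_def by (blast intro: f_inv_into_f)
    have Q_diff: "Q (x - y) = Q x - Q y" if "x \<in> G" "y \<in> G" for x y
    proof -
      have "Q (x - y + y) = Q (x - y) + Q y"
        using Q(1) that(2) subspace_diff[OF subG that] unfolding linear_operator_on_def by blast
      then show ?thesis by (simp add: algebra_simps)
    qed
    interpret pointed_contraction G q
    proof
      show "0 \<in> G" by (simp add: G_def span_zero)
      have "i (q 0) = 0"
        using iq[OF \<open>0 \<in> G\<close>] Q(2)[OF \<open>0 \<in> G\<close>] by simp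
      then show "q 0 = 0" using assms(4)[of "q 0"] by simp
      show "dist (q x) (q y) \<le> dist x y" if "x \<in> G" "y \<in> G" for x y
        using Q(2)[OF subspace_diff[OF subG that]] dist_i[of "q x" "q y"]
        by (simp add: iq Q_diff that dist_norm)
    qed
    let ?Z = "closure (span (delta ` G))"
    have "closure (span (delta ` T)) \<subseteq> ?Z"
      by (intro closure_mono span_mono image_mono) (auto simp: G_def span_base)
    then have "closure (span A) \<subseteq> ?Z"
      using T(2) closure_span_delta_subspace by (intro closure_span_minimal) auto
    then have EZ: "E \<subseteq> ?Z" using A(2) by blast
    have "closure C \<subseteq> closure (span (delta ` S))"
      using S(3) by (simp add: closure_minimal)
    then have EY: "E \<inter> ?Y \<subseteq> closure (span (delta ` S))"
      using A(2) D(2) C(3) by blast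
    define P where "P \<mu> = free_inclusion i (pushforward \<mu>)" for \<mu>
    note lin = linear_free_inclusion[of i, OF dist_i i_0]
    have "linear_operator_on E ?Y P"
      unfolding linear_operator_on_def P_def
      using EZ by (auto simp: subset_iff pushforward_add pushforward_scaleR linear_add[OF lin]
          linear_scale[OF lin] intro!: imageI pushforward_mem_free_space)
    moreover have "norm (P e) \<le> norm e" if "e \<in> E" for e
      using that EZ by (auto simp: P_def norm_free_inclusion[OF dist_i i_0] intro: norm_pushforward_le)
    moreover have "P e = e" if e: "e \<in> E \<inter> ?Y" for e
    proof (rule blinfun_eqI)
      fix f
      have "blinfun_apply (P e) f = blinfun_apply e (extension (lip0_restrict i f))"
        using e EZ by (simp add: P_def free_inclusion_apply[OF dist_i i_0] pushforward_extension subset_iff)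
      \<comment> \<open>\<open>e\<close> is supported on \<open>S \<subseteq> range i\<close>, where \<open>Q\<close> is the identity, so the extension of
        \<open>f \<circ> i \<circ> q\<close> may be replaced by \<open>f\<close>.\<close>
      also have "\<dots> = blinfun_apply e f"
      proof (rule free_functional_cong)
        show "e \<in> closure (span (delta ` S))" using e EY by blast
        fix x assume "x \<in> S"
        then have x: "x \<in> G" "x \<in> range i" using S(1) by (auto simp: G_def span_base)
        have "lip0_apply (extension (lip0_restrict i f)) x = lip0_apply f (i (q x))"
          by (simp add: extension_apply x lip0_apply_restrict[OF dist_i i_0])
        also have "i (q x) = x" using iq Q(3) x by simp
        finally show "lip0_apply (extension (lip0_restrict i f)) x = lip0_apply f x" .
      qed
      finally show "blinfun_apply (P e) f = blinfun_apply e f" .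
    qed
    ultimately show ?thesis by blast
  qed
  ultimately show ?thesis unfolding kappa_ideal_def by blast
qed

end
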